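(* Let $(W,S)$ be a Coxeter system with $W$ finite and let $J\subseteq S$. Let $Z$ be a right ideal of $W_J$ and let $Y$ be the minimal determining set of $Z$. Then $Yd_J=\{xd_J\colon x\in Y\}$ is the minimal determining set of the right ideal $Z\mathfrak X_J=\{zd\colon z\in Z,\ d\in\mathfrak X_J\}$ of $W$.
   Context: $W_J=\langle J\rangle$ is the standard parabolic subgroup, itself a Coxeter group with generating set $J$. $\mathfrak X_J$ is the set of minimum length elements in the right cosets $W_Jx$ of $W_J$ in $W$, and $d_J$ is the (unique) longest element of $\mathfrak X_J$. For $x,y$ in a Coxeter group, $x$ is a prefix of $y$ if $y$ has a reduced form beginning with a reduced form for $x$. A right ideal in a Coxeter group is a subset closed under the taking of prefixes. The minimal determining set of a right ideal $\mathscr I$ is $\{x\in\mathscr I\colon x$ is not a prefix of any other $y\in\mathscr I\}$. *)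

theory Defs
  imports "HOL-Algebra.Algebra"
begin

section \<open>Groups given by generators and relations\<close>

text \<open>
  A word over \<open>S\<close> is a list of signed letters: \<open>(s, True)\<close> stands for the generator \<open>s\<close>
  and \<open>(s, False)\<close> for its formal inverse.
\<close>

type_synonym 'a gword = "('a \<times> bool) list"

definition gwords :: "'a set \<Rightarrow> 'a gword set" where
  "gwords S = lists (S \<times> UNIV)"

definition gword_eval :: "('a, 'b) monoid_scheme \<Rightarrow> 'a gword \<Rightarrow> 'a" where
  "gword_eval G w =
     foldr (\<lambda>(s, e) x. (if e then s else inv\<^bsub>G\<^esub> s) \<otimes>\<^bsub>G\<^esub> x) w \<one>\<^bsub>G\<^esub>"

inductive gword_insert :: "'a set \<Rightarrow> 'a gword set \<Rightarrow> 'a gword \<Rightarrow> 'a gword \<Rightarrow> bool"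
  for S R where
  cancel: "u \<in> gwords S \<Longrightarrow> v \<in> gwords S \<Longrightarrow> s \<in> S \<Longrightarrow>
    gword_insert S R (u @ v) (u @ [(s, e), (s, \<not> e)] @ v)"
| relator: "u \<in> gwords S \<Longrightarrow> v \<in> gwords S \<Longrightarrow> r \<in> R \<Longrightarrow>
    gword_insert S R (u @ v) (u @ r @ v)"

text \<open>
  \<open>G\<close> is presented by the generators \<open>S\<close> and the relators \<open>R\<close>, i.e. \<open>G\<close> is the quotient of the
  free group on \<open>S\<close> by the normal closure of \<open>R\<close>: two words have the same value in \<open>G\<close> iff one
  can be turned into the other by inserting and deleting relators and pairs of mutually
  inverse letters.
\<close>

definition has_presentation ::
    "('a, 'b) monoid_scheme \<Rightarrow> 'a set \<Rightarrow> 'a gword set \<Rightarrow> bool" where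
  "has_presentation G S R \<longleftrightarrow>
     S \<subseteq> carrier G \<and> R \<subseteq> gwords S \<and> generate G S = carrier G \<and>
     (\<forall>u \<in> gwords S. \<forall>v \<in> gwords S.
        gword_eval G u = gword_eval G v \<longleftrightarrow> equivclp (gword_insert S R) u v)"


section \<open>Coxeter systems\<close>

text \<open>
  An entry \<open>0\<close> of a Coxeter matrix encodes \<open>\<infinity>\<close>; the relator \<open>(s t)\<^sup>0\<close> is then the
  empty word and imposes no relation.
\<close>

definition coxeter_matrix :: "'a set \<Rightarrow> ('a \<Rightarrow> 'a \<Rightarrow> nat) \<Rightarrow> bool" where
  "coxeter_matrix S m \<longleftrightarrow>
     (\<forall>s \<in> S. \<forall>t \<in> S. m s t = m t s \<and> (m s t = 1 \<longleftrightarrow> s = t))"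

definition coxeter_relators :: "'a set \<Rightarrow> ('a \<Rightarrow> 'a \<Rightarrow> nat) \<Rightarrow> 'a gword set" where
  "coxeter_relators S m =
     {concat (replicate (m s t) [(s, True), (t, True)]) | s t. s \<in> S \<and> t \<in> S}"

locale coxeter_system = group G for G (structure) +
  fixes S
  assumes coxeter_presentation:
    "\<exists>m. coxeter_matrix S m \<and> has_presentation G S (coxeter_relators S m)"


section \<open>Length, prefixes and right ideals\<close>

text \<open>
  In the following, \<open>G\<close> is meant to be a Coxeter group with generating set \<open>S\<close>. As elements of \<open>S\<close> are
  involutions, lists over \<open>S\<close> suffice as expressions.
\<close>

definition expression_of :: "('a, 'b) monoid_scheme \<Rightarrow> 'a set \<Rightarrow> 'a \<Rightarrow> 'a list \<Rightarrow> bool" where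
  "expression_of G S x w \<longleftrightarrow> w \<in> lists S \<and> foldr (\<otimes>\<^bsub>G\<^esub>) w \<one>\<^bsub>G\<^esub> = x"

definition cox_length :: "('a, 'b) monoid_scheme \<Rightarrow> 'a set \<Rightarrow> 'a \<Rightarrow> nat" where
  "cox_length G S x = (LEAST n. \<exists>w. expression_of G S x w \<and> length w = n)"

definition reduced_form :: "('a, 'b) monoid_scheme \<Rightarrow> 'a set \<Rightarrow> 'a \<Rightarrow> 'a list \<Rightarrow> bool" where
  "reduced_form G S x w \<longleftrightarrow> expression_of G S x w \<and> length w = cox_length G S x"

definition cox_prefix :: "('a, 'b) monoid_scheme \<Rightarrow> 'a set \<Rightarrow> 'a \<Rightarrow> 'a \<Rightarrow> bool" where
  "cox_prefix G S x y \<longleftrightarrow>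
     (\<exists>u v. reduced_form G S x u \<and> reduced_form G S y (u @ v))"

definition right_ideal :: "('a, 'b) monoid_scheme \<Rightarrow> 'a set \<Rightarrow> 'a set \<Rightarrow> bool" where
  "right_ideal G S I \<longleftrightarrow>
     I \<subseteq> carrier G \<and> (\<forall>y \<in> I. \<forall>x \<in> carrier G. cox_prefix G S x y \<longrightarrow> x \<in> I)"

definition minimal_determining_set ::
    "('a, 'b) monoid_scheme \<Rightarrow> 'a set \<Rightarrow> 'a set \<Rightarrow> 'a set" where
  "minimal_determining_set G S I = {x \<in> I. \<forall>y \<in> I. y \<noteq> x \<longrightarrow> \<not> cox_prefix G S x y}"


section \<open>Parabolic subgroups and minimal coset representatives\<close>

abbreviation parabolic :: "('a, 'b) monoid_scheme \<Rightarrow> 'a set \<Rightarrow> ('a, 'b) monoid_scheme" where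
  "parabolic G J \<equiv> subgroup_generated G J"

definition min_coset_reps :: "('a, 'b) monoid_scheme \<Rightarrow> 'a set \<Rightarrow> 'a set \<Rightarrow> 'a set" where
  "min_coset_reps G S J =
     {d. \<exists>C \<in> rcosets\<^bsub>G\<^esub> (carrier (parabolic G J)).
           d \<in> C \<and> (\<forall>x \<in> C. cox_length G S d \<le> cox_length G S x)}"

definition longest_coset_rep :: "('a, 'b) monoid_scheme \<Rightarrow> 'a set \<Rightarrow> 'a set \<Rightarrow> 'a" where
  "longest_coset_rep G S J =
     (THE d. d \<in> min_coset_reps G S J \<and>
        (\<forall>x \<in> min_coset_reps G S J. cox_length G S x \<le> cox_length G S d))"

end

theory Submission
  imports Defs
begin

text \<open>
  Both right ideals and their minimal determining sets can be tested one generator at a time.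
  A subset \<open>I\<close> is a right ideal iff \<open>y \<in> I\<close> implies \<open>ys \<in> I\<close> for every generator \<open>s\<close> that shortens \<open>y\<close>,
  because a prefix is reached by removing last letters (\<open>right_ideal_iff_steps\<close>). An element of a
  right ideal is maximal for the prefix order iff every generator that lengthens it leads out of
  the ideal (\<open>minimal_determining_set_iff_steps\<close>).

  Write an element of \<open>ZX\<^sub>J\<close> as \<open>zd\<close> with \<open>z \<in> Z\<close> and \<open>d \<in> X\<^sub>J\<close>. This is unique, and lengths add
  (\<open>WJ_XJ_unique\<close>, \<open>len_WJ_XJ\<close>). By Deodhar's lemma (\<open>XJ_mult_gen\<close>) a generator \<open>s\<close> acts on \<open>d\<close> in one
  of two ways: either \<open>ds \<in> X\<^sub>J\<close>, and \<open>zds = z(ds)\<close> keeps its factor \<open>z\<close>, or \<open>ds = td\<close> with \<open>t \<in> J\<close>, and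
  \<open>zds = (zt)d\<close>, so that the step takes place within \<open>W\<^sub>J\<close>. In both cases a shortening step
  stays in \<open>ZX\<^sub>J\<close>, which is therefore a right ideal.

  If \<open>zd\<close> is maximal, no step of the first kind can lengthen \<open>d\<close>. Such a \<open>d\<close> must be \<open>d\<^sub>J\<close>: for the
  longest element \<open>w\<close> of \<open>W\<^sub>J\<close>, every generator shortens \<open>wd\<close>, and only one element of \<open>W\<close> has this
  property (\<open>dominant_unique\<close>). For \<open>d = d\<^sub>J\<close> the lengthening steps are all of the second kind,
  and every \<open>t \<in> J\<close> occurs in one of them, because \<open>d\<^sub>J\<close> conjugates \<open>J\<close> into \<open>S\<close>
  (\<open>dominant_rep_mult_left\<close>). Hence \<open>zd\<^sub>J\<close> is maximal in \<open>ZX\<^sub>J\<close> iff \<open>z\<close> is maximal in \<open>Z\<close>.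

  The facts about lengths all come from the exchange condition, which is derived from the
  presentation by counting reflections: each word determines, for every element \<open>t\<close> of the group,
  the number of its prefixes \<open>us\<close> with \<open>t = u s (inv u)\<close>, and the parity of this number is unchanged when a
  relator is inserted, so it depends on the value of the word only (\<open>odd_reflection_cong\<close>).
\<close>

section \<open>Length and prefixes in groups generated by involutions\<close>

context group
begin

lemma inv_mult_cancel [simp]:
  "u \<in> carrier G \<Longrightarrow> x \<in> carrier G \<Longrightarrow> inv u \<otimes> (u \<otimes> x) = x"
  "u \<in> carrier G \<Longrightarrow> x \<in> carrier G \<Longrightarrow> u \<otimes> (inv u \<otimes> x) = x"
  by (simp_all flip: m_assoc)

abbreviation wprod :: "'a list \<Rightarrow> 'a" where
  "wprod w \<equiv> foldr (\<otimes>) w \<one>"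

lemma wprod_closed [simp, intro]: "set w \<subseteq> carrier G \<Longrightarrow> wprod w \<in> carrier G"
  by (induction w) auto

lemma wprod_append:
  "set u \<subseteq> carrier G \<Longrightarrow> set v \<subseteq> carrier G \<Longrightarrow> wprod (u @ v) = wprod u \<otimes> wprod v"
  by (induction u) (auto simp: m_assoc)

end

text \<open>
  Both a Coxeter group and its parabolic subgroups are instances. Treating them alike makes the
  criteria for right ideals available in \<open>W\<^sub>J\<close> without showing that \<open>W\<^sub>J\<close> is itself given by a
  Coxeter presentation.
\<close>

locale involution_generated_group = group G for G (structure) +
  fixes S
  assumes gens_closed: "S \<subseteq> carrier G"
    and gens_involutive: "s \<in> S \<Longrightarrow> s \<otimes> s = \<one>"
    and gens_generate: "generate G S = carrier G"
begin

abbreviation len :: "'a \<Rightarrow> nat" where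
  "len \<equiv> cox_length G S"

lemma gen_closed [simp, intro]: "s \<in> S \<Longrightarrow> s \<in> carrier G"
  using gens_closed by blast

lemma inv_gen [simp]: "s \<in> S \<Longrightarrow> inv s = s"
  using gens_involutive by (simp add: inv_equality)

lemma mult_gen_gen [simp]: "s \<in> S \<Longrightarrow> x \<in> carrier G \<Longrightarrow> x \<otimes> s \<otimes> s = x"
  using gens_involutive by (simp add: m_assoc)

lemma gen_gen_mult [simp]: "s \<in> S \<Longrightarrow> x \<in> carrier G \<Longrightarrow> s \<otimes> (s \<otimes> x) = x"
  using gens_involutive by (simp add: m_assoc[symmetric])

lemma word_closed: "w \<in> lists S \<Longrightarrow> set w \<subseteq> carrier G"
  using gens_closed by auto

lemma wprod_word_closed [simp, intro]: "w \<in> lists S \<Longrightarrow> wprod w \<in> carrier G"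
  by (intro wprod_closed word_closed)

lemma wprod_word_append:
  "u \<in> lists S \<Longrightarrow> v \<in> lists S \<Longrightarrow> wprod (u @ v) = wprod u \<otimes> wprod v"
  by (intro wprod_append word_closed)

lemma ex_word:
  assumes "x \<in> carrier G"
  shows "\<exists>w\<in>lists S. wprod w = x"
proof -
  have "x \<in> generate G S"
    using assms gens_generate by simp
  then show ?thesis
  proof (induction rule: generate.induct)
    case one
    show ?case by (rule bexI[of _ "[]"]) auto
  next
    case (incl h)
    then show ?case by (intro bexI[of _ "[h]"]) auto
  next
    case (inv h)
    then show ?case by (intro bexI[of _ "[h]"]) auto
  next
    case (eng h1 h2)
    then obtain u v where "u \<in> lists S" "v \<in> lists S" "wprod u = h1" "wprod v = h2"
      by blast
    then show ?case
      by (intro bexI[of _ "u @ v"]) (auto simp: wprod_word_append simp del: foldr_append)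
  qed
qed

lemma len_wprod_le: "w \<in> lists S \<Longrightarrow> len (wprod w) \<le> length w"
  unfolding cox_length_def expression_of_def by (intro Least_le) blast

lemma ex_reduced_word:
  assumes "x \<in> carrier G"
  obtains w where "w \<in> lists S" "wprod w = x" "length w = len x"
proof -
  have "\<exists>n w. expression_of G S x w \<and> length w = n"
    using ex_word[OF assms] by (auto simp: expression_of_def)
  from LeastI_ex[OF this] obtain w where "expression_of G S x w" "length w = len x"
    unfolding cox_length_def by blast
  then show ?thesis
    using that by (auto simp: expression_of_def)
qed

lemma wprod_rev: "w \<in> lists S \<Longrightarrow> wprod (rev w) = inv (wprod w)"
proof (induction w)
  case (Cons s w)
  then have "wprod (rev w @ [s]) = wprod (rev w) \<otimes> s"
    by (subst wprod_word_append) auto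
  with Cons show ?case
    by (auto simp: inv_mult_group)
qed simp

lemma len_inv: 
  assumes x: "x \<in> carrier G"
  shows "len (inv x) = len x"
proof -
  have le: "len (inv y) \<le> len y" if y: "y \<in> carrier G" for y
  proof -
    obtain w where w: "w \<in> lists S" "wprod w = y" "length w = len y"
      using y by (rule ex_reduced_word)
    then have "rev w \<in> lists S" by auto
    from len_wprod_le[OF this] w show ?thesis by (simp add: wprod_rev)
  qed
  from le[of x] le[of "inv x"] x show ?thesis by simp
qed

lemma len_mult_le:
  assumes "x \<in> carrier G" "y \<in> carrier G"
  shows "len (x \<otimes> y) \<le> len x + len y"
proof -
  obtain u where "u \<in> lists S" "wprod u = x" "length u = len x"
    using assms(1) by (rule ex_reduced_word)
  moreover obtain v where "v \<in> lists S" "wprod v = y" "length v = len y"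
    using assms(2) by (rule ex_reduced_word)
  ultimately show ?thesis
    using len_wprod_le[of "u @ v"] by (simp add: wprod_word_append del: foldr_append)
qed

lemma len_one [simp]: "len \<one> = 0"
  using len_wprod_le[of "[]"] by simp

lemma len_eq_0_iff:
  assumes "x \<in> carrier G"
  shows "len x = 0 \<longleftrightarrow> x = \<one>"
proof
  assume "len x = 0"
  obtain w where "wprod w = x" "length w = len x"
    using assms by (rule ex_reduced_word)
  with \<open>len x = 0\<close> show "x = \<one>" by simp
qed simp

lemma len_gen_le: "s \<in> S \<Longrightarrow> len s \<le> 1"
  using len_wprod_le[of "[s]"] by simp

lemma len_mult_gen_le:
  assumes "x \<in> carrier G" "s \<in> S"
  shows "len (x \<otimes> s) \<le> Suc (len x)" "len x \<le> Suc (len (x \<otimes> s))"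
  using len_mult_le[of x s] len_mult_le[of "x \<otimes> s" s] len_gen_le[of s] assms by auto

lemma len_gen_mult_le:
  assumes "x \<in> carrier G" "s \<in> S"
  shows "len (s \<otimes> x) \<le> Suc (len x)" "len x \<le> Suc (len (s \<otimes> x))"
  using len_mult_le[of s x] len_mult_le[of s "s \<otimes> x"] len_gen_le[of s] assms by auto

lemma len_eq_1_imp_gen:
  assumes "x \<in> carrier G" "len x = 1"
  shows "x \<in> S"
proof -
  obtain w where "w \<in> lists S" "wprod w = x" "length w = 1"
    using ex_reduced_word[OF assms(1)] assms(2) by metis
  then show ?thesis by (auto simp: length_Suc_conv)
qed

lemma ex_right_descent:
  assumes "x \<in> carrier G" "x \<noteq> \<one>"
  obtains s where "s \<in> S" "len x = Suc (len (x \<otimes> s))"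
proof -
  obtain w where w: "w \<in> lists S" "wprod w = x" "length w = len x"
    using assms(1) by (rule ex_reduced_word)
  with assms(2) obtain v s where v: "w = v @ [s]"
    by (cases w rule: rev_cases) auto
  have vs: "v \<in> lists S" "s \<in> S" using w v by auto
  have "x = wprod v \<otimes> s"
    using wprod_word_append[of v "[s]"] vs w v by auto
  then have "x \<otimes> s = wprod v"
    using vs by auto
  then have "len (x \<otimes> s) < len x"
    using len_wprod_le[OF vs(1)] w v by simp
  then show thesis
    using that[OF vs(2)] len_mult_gen_le[OF assms(1) vs(2)] by linarith
qed

lemma ex_left_descent:
  assumes "x \<in> carrier G" "x \<noteq> \<one>"
  obtains s where "s \<in> S" "len x = Suc (len (s \<otimes> x))"
proof -
  have "inv x \<in> carrier G" "inv x \<noteq> \<one>"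
    using assms by auto
  then obtain s where s: "s \<in> S" "len (inv x) = Suc (len (inv x \<otimes> s))"
    by (rule ex_right_descent)
  have "inv x \<otimes> s = inv (s \<otimes> x)"
    using assms s by (simp add: inv_mult_group)
  then show thesis
    using that[OF s(1)] s assms len_inv[of x] len_inv[of "s \<otimes> x"] by simp
qed

text \<open>
  Concatenated reduced words of \<open>x\<close> and \<open>v\<close> form a reduced word of \<open>xv\<close> exactly when the lengths add,
  so prefixes can be handled without mentioning words.
\<close>

lemma cox_prefix_iff:
  "cox_prefix G S x y \<longleftrightarrow>
     x \<in> carrier G \<and> (\<exists>v\<in>carrier G. y = x \<otimes> v \<and> len y = len x + len v)"
proof safe
  assume "cox_prefix G S x y"
  then obtain u v where uv: "u \<in> lists S" "v \<in> lists S" "wprod u = x" "wprod (u @ v) = y"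
      "length u = len x" "length u + length v = len y"
    unfolding cox_prefix_def reduced_form_def expression_of_def by force
  then have y: "y = x \<otimes> wprod v"
    using wprod_word_append[of u v] by simp
  show "x \<in> carrier G" using uv by auto
  have "len (wprod v) \<le> length v"
    using uv by (intro len_wprod_le)
  moreover have "len y \<le> len x + len (wprod v)"
    using y uv len_mult_le[of x "wprod v"] wprod_word_closed[of u] wprod_word_closed[of v]
    by simp
  ultimately have "len y = len x + len (wprod v)"
    using uv by linarith
  with y uv show "\<exists>v\<in>carrier G. y = x \<otimes> v \<and> len y = len x + len v"
    by auto
next
  fix v
  assume xv: "x \<in> carrier G" "v \<in> carrier G" "len (x \<otimes> v) = len x + len v"
  obtain p where p: "p \<in> lists S" "wprod p = x" "length p = len x"
    using xv(1) by (rule ex_reduced_word)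
  obtain q where q: "q \<in> lists S" "wprod q = v" "length q = len v"
    using xv(2) by (rule ex_reduced_word)
  from xv p q show "cox_prefix G S x (x \<otimes> v)"
    unfolding cox_prefix_def reduced_form_def expression_of_def
    by (intro exI[of _ p] exI[of _ q]) (simp add: wprod_word_append del: foldr_append)
qed

lemma cox_prefix_gen_step:
  assumes "x \<in> carrier G" "s \<in> S" "len x < len (x \<otimes> s)"
  shows "cox_prefix G S x (x \<otimes> s)"
  using assms len_mult_le[of x s] len_gen_le[of s]
  by (auto simp: cox_prefix_iff intro!: bexI[of _ s])

text \<open>
  A prefix of \<open>y\<close> arises from \<open>y\<close> by cancelling the letters at the end of a reduced word one after the
  other, and each cancellation shortens the element by one.
\<close>

lemma right_ideal_iff_steps:
  "right_ideal G S I \<longleftrightarrow>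
     I \<subseteq> carrier G \<and> (\<forall>y\<in>I. \<forall>s\<in>S. len (y \<otimes> s) < len y \<longrightarrow> y \<otimes> s \<in> I)"
proof safe
  fix y s
  assume I: "right_ideal G S I" and y: "y \<in> I" and s: "s \<in> S" "len (y \<otimes> s) < len y"
  from I y have "y \<in> carrier G" by (auto simp: right_ideal_def)
  with s have "cox_prefix G S (y \<otimes> s) (y \<otimes> s \<otimes> s)"
    by (intro cox_prefix_gen_step) simp_all
  with I y s \<open>y \<in> carrier G\<close> show "y \<otimes> s \<in> I"
    by (auto simp: right_ideal_def)
next
  assume I: "I \<subseteq> carrier G"
    and step: "\<forall>y\<in>I. \<forall>s\<in>S. len (y \<otimes> s) < len y \<longrightarrow> y \<otimes> s \<in> I"
  have descend: "x \<in> I" if "v \<in> lists S" "x \<in> carrier G" "x \<otimes> wprod v \<in> I"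
    "len (x \<otimes> wprod v) = len x + length v" for x v
    using that
  proof (induction v rule: rev_induct)
    case (snoc s v)
    let ?y = "x \<otimes> wprod v"
    have eq: "x \<otimes> wprod (v @ [s]) = ?y \<otimes> s"
      using snoc.prems by (subst wprod_word_append) (auto simp: m_assoc)
    have "?y \<in> carrier G" "s \<in> S" using snoc.prems by auto
    have "len ?y \<le> len x + length v"
      using snoc.prems len_mult_le[of x "wprod v"] len_wprod_le[of v]
        wprod_word_closed[of v] by simp
    moreover have "len (?y \<otimes> s) = len x + Suc (length v)"
      using snoc.prems eq by simp
    ultimately have len: "len ?y = len x + length v" "len ?y < len (?y \<otimes> s)"
      using len_mult_gen_le(1)[of ?y s] \<open>?y \<in> carrier G\<close> \<open>s \<in> S\<close> by linarith+
    have "?y \<otimes> s \<in> I"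
      using snoc.prems eq by simp
    moreover have "len (?y \<otimes> s \<otimes> s) < len (?y \<otimes> s)"
      using len \<open>s \<in> S\<close> \<open>?y \<in> carrier G\<close> by simp
    ultimately have "?y \<otimes> s \<otimes> s \<in> I"
      using step \<open>s \<in> S\<close> by blast
    then show ?case
      using snoc.IH snoc.prems len \<open>s \<in> S\<close> \<open>?y \<in> carrier G\<close> by simp
  qed auto
  show "right_ideal G S I"
    unfolding right_ideal_def
  proof (intro conjI ballI impI I)
    fix x y
    assume y: "y \<in> I" and "cox_prefix G S x y"
    then obtain v where "x \<in> carrier G" "v \<in> carrier G" "y = x \<otimes> v" "len y = len x + len v"
      by (auto simp: cox_prefix_iff)
    moreover obtain w where "w \<in> lists S" "wprod w = v" "length w = len v"
      using \<open>v \<in> carrier G\<close> by (rule ex_reduced_word)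
    ultimately show "x \<in> I"
      using descend y by metis
  qed
qed (auto simp: right_ideal_def)

text \<open>
  If \<open>x\<close> is a proper prefix of \<open>y\<close>, then the next letter \<open>s\<close> of a reduced word of \<open>y\<close> gives an element \<open>xs\<close>
  that is longer than \<open>x\<close> and, as a prefix of \<open>y\<close>, belongs to the ideal.
\<close>

lemma minimal_determining_set_iff_steps:
  assumes I: "right_ideal G S I"
  shows "x \<in> minimal_determining_set G S I \<longleftrightarrow>
    x \<in> I \<and> (\<forall>s\<in>S. len x < len (x \<otimes> s) \<longrightarrow> x \<otimes> s \<notin> I)"
proof -
  have "\<exists>s\<in>S. len x < len (x \<otimes> s) \<and> x \<otimes> s \<in> I"
    if y: "y \<in> I" "y \<noteq> x" "cox_prefix G S x y" for y
  proof -
    obtain v where x: "x \<in> carrier G" and v: "v \<in> carrier G" "y = x \<otimes> v" "len y = len x + len v"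
      using y by (auto simp: cox_prefix_iff)
    then have "v \<noteq> \<one>" using y by auto
    obtain w where w: "w \<in> lists S" "wprod w = v" "length w = len v"
      using v(1) by (rule ex_reduced_word)
    with \<open>v \<noteq> \<one>\<close> obtain s w' where sw: "w = s # w'"
      by (cases w) auto
    have s: "s \<in> S" "w' \<in> lists S" using w sw by auto
    have y': "y = x \<otimes> s \<otimes> wprod w'"
      using v w sw s x by (auto simp: m_assoc)
    have "len y \<le> len (x \<otimes> s) + len (wprod w')"
      unfolding y' using s x by (intro len_mult_le) auto
    moreover have "len (wprod w') \<le> length w'"
      using s by (intro len_wprod_le)
    moreover have "len (x \<otimes> s) \<le> Suc (len x)"
      using s x by (intro len_mult_gen_le)
    ultimately have "len x < len (x \<otimes> s)" "len y = len (x \<otimes> s) + len (wprod w')"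
      using v w sw by auto
    moreover from this have "cox_prefix G S (x \<otimes> s) y"
      using y' s x by (auto simp: cox_prefix_iff)
    ultimately show ?thesis
      using I y s x by (auto simp: right_ideal_def)
  qed
  moreover have "cox_prefix G S x (x \<otimes> s) \<and> x \<otimes> s \<noteq> x"
    if "x \<in> I" "s \<in> S" "len x < len (x \<otimes> s)" for s
    using that I cox_prefix_gen_step[of x s] by (auto simp: right_ideal_def)
  ultimately show ?thesis
    unfolding minimal_determining_set_def by blast
qed

end

section \<open>Reflections and the exchange condition\<close>

context group
begin

text \<open>
  For a word \<open>s\<^sub>1 \<dots> s\<^sub>n\<close> over involutions, the \<open>i\<close>-th entry is the reflection
  \<open>s\<^sub>1 \<dots> s\<^sub>i \<dots> s\<^sub>1\<close>. Multiplying the word by it on the left deletes the letter \<open>s\<^sub>i\<close>.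
\<close>

primrec word_reflections :: "'a list \<Rightarrow> 'a list" where
  "word_reflections [] = []"
| "word_reflections (s # w) = s # map (\<lambda>t. s \<otimes> t \<otimes> inv s) (word_reflections w)"

lemma length_word_reflections [simp]: "length (word_reflections w) = length w"
  by (induction w) auto

lemma word_reflections_closed:
  "set w \<subseteq> carrier G \<Longrightarrow> set (word_reflections w) \<subseteq> carrier G"
  by (induction w) auto

lemma word_reflections_append:
  assumes "set u \<subseteq> carrier G" "set v \<subseteq> carrier G"
  shows "word_reflections (u @ v) =
    word_reflections u @ map (\<lambda>t. wprod u \<otimes> t \<otimes> inv (wprod u)) (word_reflections v)"
  using assms
proof (induction u)
  case Nil
  then have "map (\<lambda>t. \<one> \<otimes> t \<otimes> inv \<one>) (word_reflections v) = map id (word_reflections v)"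
    using word_reflections_closed[of v] by (intro map_cong) auto
  then show ?case by simp
next
  case (Cons s u)
  then show ?case
    using word_reflections_closed[of v]
    by (auto simp: m_assoc inv_mult_group subset_iff)
qed

lemma word_reflections_nth:
  assumes "set w \<subseteq> carrier G" "i < length w"
  shows "word_reflections w ! i = wprod (take i w) \<otimes> w ! i \<otimes> inv (wprod (take i w))"
  using assms
proof (induction w arbitrary: i)
  case (Cons s w)
  show ?case
  proof (cases i)
    case 0
    with Cons.prems show ?thesis by simp
  next
    case (Suc j)
    have "set (take j w) \<subseteq> carrier G" "w ! j \<in> carrier G"
      using Cons.prems Suc set_take_subset[of j w] by auto
    with Suc Cons show ?thesis
      by (simp add: m_assoc inv_mult_group)
  qed
qed simp

lemma count_list_map_conj:
  assumes "u \<in> carrier G" "t \<in> carrier G" "set xs \<subseteq> carrier G"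
  shows "count_list (map (\<lambda>x. u \<otimes> x \<otimes> inv u) xs) t = count_list xs (inv u \<otimes> t \<otimes> u)"
  using assms(3)
proof (induction xs)
  case (Cons x xs)
  have "u \<otimes> x \<otimes> inv u = t \<longleftrightarrow> x = inv u \<otimes> t \<otimes> u"
  proof
    assume "u \<otimes> x \<otimes> inv u = t"
    then have "inv u \<otimes> t \<otimes> u = inv u \<otimes> (u \<otimes> x \<otimes> inv u) \<otimes> u"
      by simp
    then show "x = inv u \<otimes> t \<otimes> u"
      using assms(1) Cons.prems by (simp add: m_assoc)
  next
    assume "x = inv u \<otimes> t \<otimes> u"
    then show "u \<otimes> x \<otimes> inv u = t"
      using assms(1,2) by (simp add: m_assoc)
  qed
  with Cons show ?case by auto
qed simp

lemma count_word_reflections_append: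
  assumes "set u \<subseteq> carrier G" "set v \<subseteq> carrier G" "t \<in> carrier G"
  shows "count_list (word_reflections (u @ v)) t =
    count_list (word_reflections u) t +
    count_list (word_reflections v) (inv (wprod u) \<otimes> t \<otimes> wprod u)"
  using assms
  by (simp add: word_reflections_append count_list_map_conj word_reflections_closed)

definition odd_reflection :: "'a list \<Rightarrow> 'a \<Rightarrow> bool" where
  "odd_reflection w t \<longleftrightarrow> odd (count_list (word_reflections w) t)"

text \<open>
  The reflections of the inserted word \<open>r\<close> occur conjugated by \<open>u\<close>, and those of \<open>v\<close> are unaffected
  since \<open>r\<close> has value \<open>\<one>\<close>.
\<close>

lemma odd_reflection_insert:
  assumes "set u \<subseteq> carrier G" "set r \<subseteq> carrier G" "set v \<subseteq> carrier G" "t \<in> carrier G"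
    and "wprod r = \<one>" and "\<And>t. t \<in> carrier G \<Longrightarrow> \<not> odd_reflection r t"
  shows "odd_reflection (u @ r @ v) t = odd_reflection (u @ v) t"
proof -
  let ?t = "inv (wprod u) \<otimes> t \<otimes> wprod u"
  have "?t \<in> carrier G" using assms by auto
  moreover have "odd_reflection (u @ r @ v) t \<longleftrightarrow>
      odd (count_list (word_reflections u) t + (count_list (word_reflections r) ?t
        + count_list (word_reflections v) (inv (wprod r) \<otimes> ?t \<otimes> wprod r)))"
    using assms(1-4) calculation unfolding odd_reflection_def
    by (subst count_word_reflections_append, simp_all add: count_word_reflections_append)
  moreover have "even (count_list (word_reflections r) ?t)"
    using assms(6)[of ?t] calculation(1) by (simp add: odd_reflection_def)
  ultimately show ?thesis
    using assms(1-5) by (simp add: odd_reflection_def count_word_reflections_append)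
qed

lemma word_reflections_dihedral:
  assumes st: "s \<in> carrier G" "t \<in> carrier G" "s \<otimes> s = \<one>" "t \<otimes> t = \<one>"
  shows "word_reflections (concat (replicate k [s, t])) =
    map (\<lambda>i. (s \<otimes> t) [^] i \<otimes> s) [0..<2 * k]"
proof (induction k)
  case (Suc k)
  let ?c = "s \<otimes> t" and ?f = "\<lambda>i::nat. (s \<otimes> t) [^] i \<otimes> s"
  have inv: "inv s = s" "inv t = t"
    using st by (simp_all add: inv_equality)
  have shift: "s \<otimes> (t \<otimes> ?f i \<otimes> t) \<otimes> s = ?f (Suc (Suc i))" for i
  proof -
    have "?c [^] Suc (Suc i) = ?c \<otimes> ?c [^] i \<otimes> ?c"
      using st by (subst nat_pow_Suc, subst nat_pow_Suc2) auto
    then show ?thesis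
      using st by (simp add: m_assoc)
  qed
  have upt: "[0..<2 * Suc k] = 0 # 1 # map (\<lambda>i. Suc (Suc i)) [0..<2 * k]"
    by (intro nth_equalityI) (auto simp: nth_Cons simp del: upt_Suc split: nat.splits)
  show ?case
    unfolding upt using st Suc inv by (simp add: shift)
qed simp

end

context coxeter_system
begin

lemma obtain_presentation:
  obtains m where "coxeter_matrix S m" "S \<subseteq> carrier G" "generate G S = carrier G"
    "\<And>u v. u \<in> gwords S \<Longrightarrow> v \<in> gwords S \<Longrightarrow>
       gword_eval G u = gword_eval G v \<longleftrightarrow>
       equivclp (gword_insert S (coxeter_relators S m)) u v"
  using coxeter_presentation by (auto simp: has_presentation_def)

lemma dihedral_gword:
  "s \<in> S \<Longrightarrow> t \<in> S \<Longrightarrow> concat (replicate k [(s, True), (t, True)]) \<in> gwords S"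
  by (induction k) (auto simp: gwords_def)

lemma relator_eval:
  assumes "coxeter_matrix S m"
    and pres: "\<And>u v. u \<in> gwords S \<Longrightarrow> v \<in> gwords S \<Longrightarrow>
       gword_eval G u = gword_eval G v \<longleftrightarrow>
       equivclp (gword_insert S (coxeter_relators S m)) u v"
    and st: "s \<in> S" "t \<in> S"
  shows "gword_eval G (concat (replicate (m s t) [(s, True), (t, True)])) = \<one>"
proof -
  let ?r = "concat (replicate (m s t) [(s, True), (t, True)])"
  have "gword_insert S (coxeter_relators S m) ([] @ []) ([] @ ?r @ [])"
    using st by (intro gword_insert.relator) (auto simp: gwords_def coxeter_relators_def)
  then have "equivclp (gword_insert S (coxeter_relators S m)) [] ?r"
    by (intro r_into_equivclp) simp
  moreover have "?r \<in> gwords S" "[] \<in> gwords S"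
    using st dihedral_gword by (auto simp: gwords_def)
  ultimately show ?thesis
    using pres[of "[]" ?r] by (simp add: gword_eval_def)
qed

end

sublocale coxeter_system \<subseteq> involution_generated_group G S
proof
  obtain m where m: "coxeter_matrix S m" "S \<subseteq> carrier G" "generate G S = carrier G"
    "\<And>u v. u \<in> gwords S \<Longrightarrow> v \<in> gwords S \<Longrightarrow>
       gword_eval G u = gword_eval G v \<longleftrightarrow>
       equivclp (gword_insert S (coxeter_relators S m)) u v"
    by (rule obtain_presentation) blast
  show "S \<subseteq> carrier G" "generate G S = carrier G" by fact+
  fix s assume s: "s \<in> S"
  then have "m s s = 1" using m(1) by (auto simp: coxeter_matrix_def)
  then show "s \<otimes> s = \<one>"
    using relator_eval[OF m(1,4) s s] s m(2) by (auto simp: gword_eval_def)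
qed

context coxeter_system
begin

lemma gword_eval_eq_wprod: "w \<in> gwords S \<Longrightarrow> gword_eval G w = wprod (map fst w)"
  by (induction w) (auto simp: gwords_def gword_eval_def)

lemma gwords_map_fst: "w \<in> gwords S \<Longrightarrow> map fst w \<in> lists S"
  by (induction w) (auto simp: gwords_def)

text \<open>
  The reflections \<open>(st)\<^sup>i s\<close> of \<open>(st)\<^sup>k\<close>, for \<open>i < 2k\<close>, run twice through the same list because
  \<open>(st)\<^sup>k = \<one>\<close>; so each occurs an even number of times.
\<close>

lemma odd_reflection_relator:
  assumes "s \<in> S" "t \<in> S" "(s \<otimes> t) [^] (k::nat) = \<one>"
  shows "\<not> odd_reflection (concat (replicate k [s, t])) x"
proof -
  let ?f = "\<lambda>i::nat. (s \<otimes> t) [^] i \<otimes> s"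
  have "[0..<2 * k] = [0..<k] @ map (\<lambda>i. i + k) [0..<k]"
    by (intro nth_equalityI) (auto simp: nth_append)
  moreover have "?f (i + k) = ?f i" for i
    using assms by (simp add: nat_pow_mult[symmetric])
  ultimately have "map ?f [0..<2 * k] = map ?f [0..<k] @ map ?f [0..<k]"
    by (simp add: o_def)
  then show ?thesis
    using assms gens_involutive
    by (simp add: odd_reflection_def word_reflections_dihedral)
qed

lemma wprod_dihedral:
  "s \<in> S \<Longrightarrow> t \<in> S \<Longrightarrow> wprod (concat (replicate k [s, t])) = (s \<otimes> t) [^] (k::nat)"
proof (induction k)
  case (Suc k)
  then have "(s \<otimes> t) [^] Suc k = (s \<otimes> t) \<otimes> (s \<otimes> t) [^] k"
    by (intro nat_pow_Suc2) auto
  with Suc show ?case by (simp add: m_assoc del: nat_pow_Suc)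
qed simp

text \<open>
  Both kinds of inserted word, \<open>ss\<close> and \<open>(st)\<^sup>m\<close>, have value \<open>\<one>\<close> and contain each reflection an even
  number of times.
\<close>

lemma odd_reflection_gword_insert:
  assumes "coxeter_matrix S m"
    and pres: "\<And>u v. u \<in> gwords S \<Longrightarrow> v \<in> gwords S \<Longrightarrow>
       gword_eval G u = gword_eval G v \<longleftrightarrow>
       equivclp (gword_insert S (coxeter_relators S m)) u v"
    and "gword_insert S (coxeter_relators S m) p q" "x \<in> carrier G"
  shows "odd_reflection (map fst p) x = odd_reflection (map fst q) x"
  using assms(3)
proof cases
  case (cancel u v s e)
  have "odd_reflection (map fst u @ [s, s] @ map fst v) x = odd_reflection (map fst u @ map fst v) x"
  proof (rule odd_reflection_insert)
    show "\<not> odd_reflection [s, s] t" for t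
      using cancel gens_involutive by (simp add: odd_reflection_def)
    show "set (map fst u) \<subseteq> carrier G" "set (map fst v) \<subseteq> carrier G"
      using cancel by (intro word_closed gwords_map_fst; simp)+
  qed (use cancel gens_involutive assms(4) in auto)
  with cancel show ?thesis by simp
next
  case (relator u v r)
  then obtain s t where st: "s \<in> S" "t \<in> S" "r = concat (replicate (m s t) [(s, True), (t, True)])"
    by (auto simp: coxeter_relators_def)
  have r: "map fst r = concat (replicate (m s t) [s, t])"
    by (simp add: st(3) map_concat)
  have "r \<in> gwords S"
    using st dihedral_gword by simp
  then have "wprod (map fst r) = \<one>"
    using relator_eval[OF assms(1) pres st(1,2)] st gword_eval_eq_wprod by simp
  then have "(s \<otimes> t) [^] m s t = \<one>"
    using wprod_dihedral[OF st(1,2)] r by simp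
  then have "\<not> odd_reflection (map fst r) t" for t
    using odd_reflection_relator[OF st(1,2)] r by simp
  then have "odd_reflection (map fst u @ map fst r @ map fst v) x =
      odd_reflection (map fst u @ map fst v) x"
    by (intro odd_reflection_insert word_closed gwords_map_fst)
      (use relator \<open>r \<in> gwords S\<close> \<open>wprod (map fst r) = \<one>\<close> assms(4) in auto)
  with relator show ?thesis by simp
qed

text \<open>
  This is the only use of the fact that the Coxeter relations suffice to define the group.
\<close>

lemma odd_reflection_cong:
  assumes "u \<in> lists S" "v \<in> lists S" "wprod u = wprod v" "x \<in> carrier G"
  shows "odd_reflection u x = odd_reflection v x"
proof -
  obtain m where m: "coxeter_matrix S m" "S \<subseteq> carrier G" "generate G S = carrier G"
    "\<And>u v. u \<in> gwords S \<Longrightarrow> v \<in> gwords S \<Longrightarrow>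
       gword_eval G u = gword_eval G v \<longleftrightarrow>
       equivclp (gword_insert S (coxeter_relators S m)) u v"
    by (rule obtain_presentation) blast
  let ?g = "map (\<lambda>s. (s, True))"
  have g: "?g u \<in> gwords S" "?g v \<in> gwords S" "map fst (?g u) = u" "map fst (?g v) = v"
    using assms by (auto simp: gwords_def o_def)
  then have "equivclp (gword_insert S (coxeter_relators S m)) (?g u) (?g v)"
    using m(4)[of "?g u" "?g v"] gword_eval_eq_wprod[of "?g u"] gword_eval_eq_wprod[of "?g v"]
      assms(3) by simp
  then have "odd_reflection (map fst (?g u)) x = odd_reflection (map fst (?g v)) x"
  proof (induction rule: equivclp_induct)
    case (step y z)
    then show ?case
      using odd_reflection_gword_insert[OF m(1,4) _ assms(4)] by blast
  qed simp
  then show ?thesis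
    by (simp only: g)
qed

lemma reflection_deletes_letter:
  assumes w: "w \<in> lists S" and i: "i < length w"
  shows "word_reflections w ! i \<otimes> wprod w = wprod (take i w @ drop (Suc i) w)"
proof -
  let ?a = "take i w" and ?b = "drop (Suc i) w"
  have eq: "w = ?a @ w ! i # ?b"
    using i by (rule id_take_nth_drop)
  have ab: "?a \<in> lists S" "?b \<in> lists S" "w ! i \<in> S"
    using w i by (auto dest: in_set_takeD in_set_dropD)
  have "wprod w = wprod ?a \<otimes> (w ! i \<otimes> wprod ?b)"
    using ab by (subst eq, subst wprod_word_append) auto
  moreover have "word_reflections w ! i = wprod ?a \<otimes> w ! i \<otimes> inv (wprod ?a)"
    using w i by (intro word_reflections_nth word_closed)
  moreover have "wprod ?a \<in> carrier G" "wprod ?b \<in> carrier G"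
    using ab by blast+
  moreover have "wprod (?a @ ?b) = wprod ?a \<otimes> wprod ?b"
    using ab by (intro wprod_word_append)
  moreover have "w ! i \<in> carrier G" using ab by blast
  ultimately show ?thesis
    using ab(3) by (simp add: m_assoc del: foldr_append)
qed

text \<open>
  The reflections of \<open>w @ [s]\<close> are those of \<open>w\<close> and, as the last one, \<open>w s (inv w)\<close>.
\<close>

lemma odd_reflection_snoc:
  assumes w: "w \<in> lists S" and s: "s \<in> S"
  shows "odd_reflection (w @ [s]) (wprod w \<otimes> s \<otimes> inv (wprod w)) \<longleftrightarrow>
    \<not> odd_reflection w (wprod w \<otimes> s \<otimes> inv (wprod w))"
proof -
  have "wprod w \<in> carrier G" using w by blast
  then have "inv (wprod w) \<otimes> (wprod w \<otimes> s \<otimes> inv (wprod w)) \<otimes> wprod w = s"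
    using s by (simp add: m_assoc)
  then show ?thesis
    using w s \<open>wprod w \<in> carrier G\<close>
    by (simp add: odd_reflection_def count_word_reflections_append word_closed)
qed

lemma odd_reflection_imp_deletion:
  assumes w: "w \<in> lists S" and s: "s \<in> S"
    and odd: "odd_reflection w (wprod w \<otimes> s \<otimes> inv (wprod w))"
  shows "\<exists>i<length w. wprod w \<otimes> s = wprod (take i w @ drop (Suc i) w)"
proof -
  let ?t = "wprod w \<otimes> s \<otimes> inv (wprod w)"
  have "?t \<in> set (word_reflections w)"
    using odd by (metis count_notin even_zero odd_reflection_def)
  then obtain i where i: "i < length w" "word_reflections w ! i = ?t"
    by (auto simp: in_set_conv_nth)
  have "wprod w \<in> carrier G" using w by blast
  then have "?t \<otimes> wprod w = wprod w \<otimes> s"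
    using s by (simp add: m_assoc)
  then show ?thesis
    using reflection_deletes_letter[OF w i(1)] i by metis
qed

lemma length_delete_less:
  assumes "w \<in> lists S" "i < length w"
  shows "len (wprod (take i w @ drop (Suc i) w)) < length w"
proof -
  have "take i w @ drop (Suc i) w \<in> lists S"
    using assms(1) by (auto dest: in_set_takeD in_set_dropD)
  from len_wprod_le[OF this] assms(2) show ?thesis by simp
qed

lemma odd_reflection_imp_shorter:
  assumes w: "w \<in> lists S" and s: "s \<in> S"
    and odd: "odd_reflection w (wprod w \<otimes> s \<otimes> inv (wprod w))"
  shows "len (wprod w \<otimes> s) < len (wprod w)"
proof -
  have "wprod w \<in> carrier G" using w by blast
  then obtain v where v: "v \<in> lists S" "wprod v = wprod w" "length v = len (wprod w)"
    by (rule ex_reduced_word)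
  have "odd_reflection v (wprod v \<otimes> s \<otimes> inv (wprod v))"
    using odd odd_reflection_cong[OF w v(1)] v(2) s \<open>wprod w \<in> carrier G\<close> by simp
  from odd_reflection_imp_deletion[OF v(1) s this] obtain i where
    "i < length v" "wprod w \<otimes> s = wprod (take i v @ drop (Suc i) v)"
    using v(2) by auto
  with length_delete_less[OF v(1), of i] v(3) show ?thesis by simp
qed

text \<open>
  Let \<open>t = x s (inv x)\<close>, where \<open>x\<close> is the value of \<open>w\<close>. If \<open>t\<close> occurs an odd number of times among the
  reflections of \<open>w\<close>, it occurs at least once, and \<open>xs = tx\<close> is obtained by deleting a letter.
  Otherwise it occurs an odd number of times for \<open>w @ [s]\<close>, and the same argument shows that \<open>x\<close> is
  shorter than \<open>xs\<close>.
\<close>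

theorem exchange:
  assumes w: "w \<in> lists S" and s: "s \<in> S"
    and len: "len (wprod w \<otimes> s) \<le> len (wprod w)"
  shows "\<exists>i<length w. wprod w \<otimes> s = wprod (take i w @ drop (Suc i) w)"
proof (rule odd_reflection_imp_deletion[OF w s], rule ccontr)
  let ?x = "wprod w" and ?t = "wprod w \<otimes> s \<otimes> inv (wprod w)"
  assume "\<not> odd_reflection w ?t"
  then have odd: "odd_reflection (w @ [s]) ?t"
    using odd_reflection_snoc w s by simp
  have x: "?x \<in> carrier G" using w by blast
  have ws: "w @ [s] \<in> lists S" using w s by simp
  have xs: "wprod (w @ [s]) = ?x \<otimes> s"
    using w s by (subst wprod_word_append) auto
  have "?x \<otimes> s \<otimes> s \<otimes> inv (?x \<otimes> s) = ?t"
    using x s by (simp add: inv_mult_group m_assoc)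
  then have "len (?x \<otimes> s \<otimes> s) < len (?x \<otimes> s)"
    using odd_reflection_imp_shorter[OF ws s] odd unfolding xs by simp
  then show False
    using len x s by simp
qed

text \<open>
  The letter that the exchange condition deletes from a word of \<open>xy\<close> lies either in the part for \<open>y\<close> or
  in the part for \<open>x\<close>. In this form the condition speaks of elements only.
\<close>

theorem exchange_split:
  assumes x: "x \<in> carrier G" and y: "y \<in> carrier G" and s: "s \<in> S"
    and len: "len (x \<otimes> y \<otimes> s) \<le> len (x \<otimes> y)"
  obtains "len (y \<otimes> s) < len y"
  | x' where "x' \<in> carrier G" "len x' < len x" "x \<otimes> y \<otimes> s = x' \<otimes> y"
proof -
  obtain u where u: "u \<in> lists S" "wprod u = x" "length u = len x"
    using x by (rule ex_reduced_word)
  obtain v where v: "v \<in> lists S" "wprod v = y" "length v = len y"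
    using y by (rule ex_reduced_word)
  have uv: "u @ v \<in> lists S" "wprod (u @ v) = x \<otimes> y"
    using u v wprod_word_append[of u v] by simp_all
  obtain i where i: "i < length (u @ v)"
    "x \<otimes> y \<otimes> s = wprod (take i (u @ v) @ drop (Suc i) (u @ v))"
    using exchange[OF uv(1) s] len unfolding uv(2) by blast
  show thesis
  proof (cases "i < length u")
    case True
    let ?u = "take i u @ drop (Suc i) u"
    have u': "?u \<in> lists S"
      using u by (auto dest: in_set_takeD in_set_dropD)
    have "x \<otimes> y \<otimes> s = wprod (?u @ v)"
      using i(2) True by simp
    also have "\<dots> = wprod ?u \<otimes> y"
      using wprod_word_append[OF u' v(1)] v by simp
    finally show thesis
      using length_delete_less[OF u(1) True] u(3) wprod_word_closed[OF u']
      by (intro that(2)) simp_all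
  next
    case False
    define j where "j = i - length u"
    let ?v = "take j v @ drop (Suc j) v"
    have j: "i = length u + j" "j < length v"
      using False i(1) by (auto simp: j_def)
    have v': "?v \<in> lists S"
      using v by (auto dest: in_set_takeD in_set_dropD)
    have "x \<otimes> (y \<otimes> s) = wprod (u @ ?v)"
      using i(2) x y s by (simp add: j m_assoc)
    also have "\<dots> = x \<otimes> wprod ?v"
      using wprod_word_append[OF u(1) v'] u by simp
    finally have "y \<otimes> s = wprod ?v"
      using x y s wprod_word_closed[OF v'] by (simp del: foldr_append)
    then show thesis
      using length_delete_less[OF v(1) j(2)] v(3) by (intro that(1)) simp
  qed
qed

corollary exchange_split_left:
  assumes x: "x \<in> carrier G" and y: "y \<in> carrier G" and s: "s \<in> S"
    and len: "len (s \<otimes> (x \<otimes> y)) \<le> len (x \<otimes> y)"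
  obtains "len (s \<otimes> x) < len x"
  | y' where "y' \<in> carrier G" "len y' < len y" "s \<otimes> (x \<otimes> y) = x \<otimes> y'"
proof -
  have inv: "inv y \<otimes> inv x \<otimes> s = inv (s \<otimes> (x \<otimes> y))" "inv y \<otimes> inv x = inv (x \<otimes> y)"
    "inv x \<otimes> s = inv (s \<otimes> x)"
    using x y s by (simp_all add: inv_mult_group)
  have closed: "inv x \<in> carrier G" "inv y \<in> carrier G" "s \<in> carrier G"
    using x y s by auto
  have "len (inv y \<otimes> inv x \<otimes> s) \<le> len (inv y \<otimes> inv x)"
    unfolding inv(1) unfolding inv(2) using len x y closed(3) by (simp only: len_inv m_closed)
  then show thesis
  proof (rule exchange_split[OF closed(2,1) s])
    assume "len (inv x \<otimes> s) < len (inv x)"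
    then show thesis
      unfolding inv using x closed(3) that(1) by (simp only: len_inv m_closed)
  next
    fix z
    assume z: "z \<in> carrier G" "len z < len (inv y)" "inv y \<otimes> inv x \<otimes> s = z \<otimes> inv x"
    have "s \<otimes> (x \<otimes> y) = inv (z \<otimes> inv x)"
      using x y closed(3) unfolding z(3)[symmetric] inv(1) by simp
    also have "\<dots> = x \<otimes> inv z"
      using x z(1) by (simp add: inv_mult_group)
    finally show thesis
      using z y by (intro that(2)[of "inv z"]) (simp_all add: len_inv)
  qed
qed

corollary len_mult_gen_cases:
  assumes "x \<in> carrier G" "s \<in> S"
  shows "len x = Suc (len (x \<otimes> s)) \<or> len (x \<otimes> s) = Suc (len x)"
proof (cases "len (x \<otimes> s) \<le> len x")
  case True
  then have "len (x \<otimes> \<one> \<otimes> s) \<le> len (x \<otimes> \<one>)"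
    using assms by simp
  then have "len (x \<otimes> s) < len x"
    by (rule exchange_split[OF assms(1) one_closed assms(2)]) (use assms in simp_all)
  then show ?thesis
    using len_mult_gen_le[OF assms] by linarith
next
  case False
  then show ?thesis
    using len_mult_gen_le[OF assms] by linarith
qed

end

section \<open>Elements all of whose generators are right descents\<close>

context coxeter_system
begin

text \<open>
  In a finite Coxeter group the longest element is the only one with this property. Describing it
  by its descents rather than by its length lets other elements be identified with it.
\<close>

definition dominant :: "'a \<Rightarrow> bool" where
  "dominant w \<longleftrightarrow> w \<in> carrier G \<and> (\<forall>s\<in>S. len (w \<otimes> s) < len w)"

text \<open>
  Induction on \<open>y\<close>: let \<open>w = az\<close> with adding lengths and let \<open>zs\<close> be longer than \<open>z\<close>. As \<open>s\<close> shortens \<open>w\<close>,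
  the exchange condition turns \<open>azs\<close> into \<open>a'z\<close> with a shorter \<open>a'\<close>, and \<open>w = a'(zs)\<close>.
\<close>

lemma dominant_suffix:
  assumes w: "dominant w" and "y \<in> carrier G"
  shows "\<exists>a\<in>carrier G. w = a \<otimes> y \<and> len w = len a + len y"
  using assms(2)
proof (induction "len y" arbitrary: y)
  case 0
  then show ?case
    using w by (auto simp: len_eq_0_iff dominant_def)
next
  case (Suc n)
  from Suc have "y \<noteq> \<one>" by auto
  with Suc.prems obtain s where s: "s \<in> S" "len y = Suc (len (y \<otimes> s))"
    by (rule ex_right_descent)
  define z where "z = y \<otimes> s"
  have z: "z \<in> carrier G" "z \<otimes> s = y" "len y = Suc (len z)"
    using s Suc.prems by (simp_all add: z_def)
  then obtain a where a: "a \<in> carrier G" "w = a \<otimes> z" "len w = len a + len z"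
    using Suc.hyps by (metis nat.inject)
  have "len (a \<otimes> z \<otimes> s) \<le> len (a \<otimes> z)"
    using w a s(1) by (auto simp: dominant_def)
  then show ?case
  proof (rule exchange_split[OF a(1) z(1) s(1)])
    assume "len (z \<otimes> s) < len z"
    then show ?thesis using z by simp
  next
    fix a'
    assume a': "a' \<in> carrier G" "len a' < len a" "a \<otimes> z \<otimes> s = a' \<otimes> z"
    have "w = a \<otimes> z \<otimes> s \<otimes> s"
      using a z s(1) by simp
    then have "w = a' \<otimes> y"
      using a' z s(1) by (auto simp: m_assoc)
    moreover have "len w \<le> len a' + len y"
      unfolding \<open>w = a' \<otimes> y\<close> using a' Suc.prems by (intro len_mult_le)
    ultimately show ?thesis
      using a a' z by (intro bexI[of _ a']) auto
  qed
qed

lemma dominant_unique: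
  assumes "dominant v" "dominant w"
  shows "v = w"
proof -
  have vw: "v \<in> carrier G" "w \<in> carrier G"
    using assms by (auto simp: dominant_def)
  obtain a where a: "a \<in> carrier G" "v = a \<otimes> w" "len v = len a + len w"
    using dominant_suffix[OF assms(1) vw(2)] by blast
  obtain b where "len w = len b + len v"
    using dominant_suffix[OF assms(2) vw(1)] by blast
  with a have "a = \<one>"
    by (simp add: len_eq_0_iff[symmetric])
  with a vw show ?thesis by simp
qed

end

section \<open>Minimal coset representatives\<close>

locale parabolic_coxeter_system = coxeter_system +
  fixes J
  assumes J_subset: "J \<subseteq> S"
begin

abbreviation WJ :: "'a set" where
  "WJ \<equiv> carrier (parabolic G J)"

abbreviation XJ :: "'a set" where
  "XJ \<equiv> min_coset_reps G S J"

lemma J_gen: "t \<in> J \<Longrightarrow> t \<in> S"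
  using J_subset by blast

lemma subgroup_WJ: "subgroup WJ G"
  unfolding carrier_subgroup_generated by (intro generate_is_subgroup) auto

lemma WJ_closed [simp]: "w \<in> WJ \<Longrightarrow> w \<in> carrier G"
  using subgroup.mem_carrier[OF subgroup_WJ] .

lemma J_in_WJ: "t \<in> J \<Longrightarrow> t \<in> WJ"
  unfolding carrier_subgroup_generated using J_gen by (intro generate.incl) auto

lemma WJ_mult [simp]: "v \<in> WJ \<Longrightarrow> w \<in> WJ \<Longrightarrow> v \<otimes> w \<in> WJ"
  using subgroup.m_closed[OF subgroup_WJ] .

lemma WJ_inv [simp]: "w \<in> WJ \<Longrightarrow> inv w \<in> WJ"
  using subgroup.m_inv_closed[OF subgroup_WJ] .

lemma WJ_one [simp]: "\<one> \<in> WJ"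
  using subgroup.one_closed[OF subgroup_WJ] .

end

sublocale parabolic_coxeter_system \<subseteq> P: involution_generated_group "parabolic G J" J
proof (intro involution_generated_group.intro involution_generated_group_axioms.intro)
  show "group (parabolic G J)" by simp
  show "J \<subseteq> WJ" using J_in_WJ by blast
  show "s \<otimes>\<^bsub>parabolic G J\<^esub> s = \<one>\<^bsub>parabolic G J\<^esub>" if "s \<in> J" for s
    using that J_gen gens_involutive by simp
  have "WJ \<inter> J = J" using J_in_WJ by blast
  then show "generate (parabolic G J) J = WJ"
    using carrier_subgroup_generated[of "parabolic G J" J] by simp
qed

context parabolic_coxeter_system
begin

text \<open>
  Deleting a letter from a word over \<open>J\<close> leaves a word over \<open>J\<close>. By the exchange condition, if a
  letter of \<open>J\<close> fails to lengthen an element of \<open>W\<^sub>J\<close> with respect to \<open>S\<close>, it also fails to do so with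
  respect to \<open>J\<close>.
\<close>

lemma parabolic_len:
  assumes "x \<in> WJ"
  shows "P.len x = len x"
  using assms
proof (induction "P.len x" arbitrary: x)
  case 0
  then show ?case using P.len_eq_0_iff[of x] by simp
next
  case (Suc n)
  then have "x \<noteq> \<one>\<^bsub>parabolic G J\<^esub>" by (metis P.len_one nat.distinct(1))
  with Suc.prems obtain s where s: "s \<in> J" "P.len x = Suc (P.len (x \<otimes> s))"
    by (rule P.ex_right_descent) simp
  \<comment> \<open>Here \<open>x = ys\<close> with \<open>y\<close> one shorter with respect to \<open>J\<close>; the same has to hold for \<open>S\<close>.\<close>
  define y where "y = x \<otimes> s"
  have sS: "s \<in> S" using s(1) by (rule J_gen)
  have y: "y \<in> WJ" "y \<otimes> s = x" "P.len x = Suc (P.len y)"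
    using s sS Suc.prems J_in_WJ[OF s(1)] by (simp_all add: y_def)
  have IH: "P.len y = len y"
    using Suc.hyps y by simp
  obtain w where w: "w \<in> lists J" "wprod w = y" "length w = P.len y"
    using P.ex_reduced_word[OF y(1)] by auto
  have wS: "w \<in> lists S"
    using w(1) lists_mono[OF J_subset] by blast
  have "\<not> len (wprod w \<otimes> s) \<le> len (wprod w)"
  proof
    assume "len (wprod w \<otimes> s) \<le> len (wprod w)"
    from exchange[OF wS sS this] obtain i where i: "i < length w"
      "x = wprod (take i w @ drop (Suc i) w)"
      using w(2) y(2) by auto
    have "take i w @ drop (Suc i) w \<in> lists J"
      using w(1) by (auto dest: in_set_takeD in_set_dropD)
    from P.len_wprod_le[OF this] i w(3) y(3) show False by simp
  qed
  then have "len x = Suc (len y)"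
    using len_mult_gen_le(1)[of y s] y sS w(2) by simp
  then show ?case using y IH by simp
qed

lemma mem_XJ_iff: "d \<in> XJ \<longleftrightarrow> d \<in> carrier G \<and> (\<forall>w\<in>WJ. len d \<le> len (w \<otimes> d))"
proof
  assume "d \<in> XJ"
  then obtain a where a: "a \<in> carrier G" "d \<in> WJ #> a" "\<forall>x\<in>WJ #> a. len d \<le> len x"
    by (auto simp: min_coset_reps_def RCOSETS_def)
  then have "WJ #> a = WJ #> d"
    using repr_independence[OF _ _ subgroup_WJ] by blast
  moreover have "w \<otimes> d \<in> WJ #> d" if "w \<in> WJ" for w
    using that by (auto simp: r_coset_def)
  moreover have "d \<in> carrier G"
    using a by (auto simp: r_coset_def)
  ultimately show "d \<in> carrier G \<and> (\<forall>w\<in>WJ. len d \<le> len (w \<otimes> d))"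
    using a(3) by blast
next
  assume d: "d \<in> carrier G \<and> (\<forall>w\<in>WJ. len d \<le> len (w \<otimes> d))"
  then have "d \<in> WJ #> d" "WJ #> d \<in> rcosets WJ"
    using rcos_self[OF _ subgroup_WJ] rcosetsI[OF subgroup.subset[OF subgroup_WJ]] by simp_all
  moreover have "\<forall>x\<in>WJ #> d. len d \<le> len x"
    using d by (simp add: r_coset_def)
  ultimately show "d \<in> XJ"
    unfolding min_coset_reps_def by blast
qed

lemma XJ_closed [simp]: "d \<in> XJ \<Longrightarrow> d \<in> carrier G"
  by (simp add: mem_XJ_iff)

text \<open>
  Build up \<open>w\<close> from the right, letter by letter. A letter that failed to lengthen the product could be
  exchanged against one of \<open>d\<close>, giving an element of the coset \<open>W\<^sub>J d\<close> shorter than \<open>d\<close>.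
\<close>

lemma len_WJ_XJ:
  assumes "w \<in> WJ" and d: "d \<in> XJ"
  shows "len (w \<otimes> d) = len w + len d"
  using assms(1)
proof (induction "P.len w" arbitrary: w)
  case 0
  then have "w = \<one>" using P.len_eq_0_iff[of w] by simp
  then show ?case using d by simp
next
  case (Suc n)
  then have "w \<noteq> \<one>\<^bsub>parabolic G J\<^esub>" by (metis P.len_one nat.distinct(1))
  with Suc.prems obtain s where s: "s \<in> J" "P.len w = Suc (P.len (s \<otimes> w))"
    by (rule P.ex_left_descent) simp
  define v where "v = s \<otimes> w"
  have sS: "s \<in> S" using s(1) by (rule J_gen)
  have v: "v \<in> WJ" "s \<otimes> v = w" "P.len w = Suc (P.len v)"
    using s sS Suc.prems J_in_WJ[OF s(1)] by (simp_all add: v_def)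
  have w: "len w = Suc (len v)"
    using v Suc.prems by (simp add: parabolic_len)
  have IH: "len (v \<otimes> d) = len v + len d"
    using Suc.hyps v by simp
  have wd: "w \<otimes> d = s \<otimes> (v \<otimes> d)"
    using v d sS by (auto simp: m_assoc)
  have "\<not> len (s \<otimes> (v \<otimes> d)) \<le> len (v \<otimes> d)"
  proof
    assume "len (s \<otimes> (v \<otimes> d)) \<le> len (v \<otimes> d)"
    then show False
    proof (rule exchange_split_left[OF WJ_closed[OF v(1)] XJ_closed[OF d] sS])
      assume "len (s \<otimes> v) < len v"
      then show False using v w by simp
    next
      fix d'
      assume d': "d' \<in> carrier G" "len d' < len d" "s \<otimes> (v \<otimes> d) = v \<otimes> d'"
      then have "inv v \<otimes> (s \<otimes> (v \<otimes> d)) = d'"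
        using v by simp
      then have "d' = (inv v \<otimes> (s \<otimes> v)) \<otimes> d"
        using v(1) d sS by (simp add: m_assoc)
      moreover have "inv v \<otimes> (s \<otimes> v) \<in> WJ"
        using v(1) J_in_WJ[OF s(1)] by simp
      ultimately show False
        using d d'(2) by (auto simp: mem_XJ_iff)
    qed
  qed
  then show ?case
    using IH w wd len_gen_mult_le(1)[of "v \<otimes> d" s] v d sS by simp
qed

lemma ex_WJ_XJ:
  assumes "x \<in> carrier G"
  obtains w d where "w \<in> WJ" "d \<in> XJ" "x = w \<otimes> d"
proof -
  obtain v where v: "v \<in> WJ" "\<And>w. w \<in> WJ \<Longrightarrow> len (v \<otimes> x) \<le> len (w \<otimes> x)"
    using ex_has_least_nat[of "\<lambda>v. v \<in> WJ" \<one> "\<lambda>v. len (v \<otimes> x)"] by auto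
  define d where "d = v \<otimes> x"
  have "len d \<le> len (w \<otimes> d)" if "w \<in> WJ" for w
    using v(2)[of "w \<otimes> v"] that v(1) assms by (simp add: d_def m_assoc)
  then have "d \<in> XJ"
    using v(1) assms by (simp add: mem_XJ_iff d_def)
  moreover have "x = inv v \<otimes> d"
    using v(1) assms by (simp add: d_def)
  ultimately show thesis
    using that[of "inv v" d] v(1) by simp
qed

lemma WJ_XJ_unique:
  assumes "v \<in> WJ" "w \<in> WJ" "c \<in> XJ" "d \<in> XJ" "v \<otimes> c = w \<otimes> d"
  shows "v = w \<and> c = d"
proof -
  have eq: "inv w \<otimes> v \<otimes> c = d" "inv v \<otimes> w \<otimes> d = c"
    using assms by (simp_all add: m_assoc) (simp flip: assms(5))
  have "len d = len (inv w \<otimes> v) + len c" "len c = len (inv v \<otimes> w) + len d"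
    using len_WJ_XJ[of "inv w \<otimes> v" c] len_WJ_XJ[of "inv v \<otimes> w" d] assms eq by simp_all
  then have "len (inv w \<otimes> v) = 0" by simp
  then have *: "inv w \<otimes> v = \<one>"
    using assms by (simp add: len_eq_0_iff)
  then have "c = d" using eq assms by simp
  moreover have "v = w \<otimes> (inv w \<otimes> v)"
    using assms by simp
  then have "v = w" using * assms by simp
  ultimately show ?thesis by simp
qed

text \<open>
  Deodhar's lemma. If \<open>ds = wc\<close> with \<open>w \<noteq> \<one>\<close>, some \<open>t \<in> J\<close> shortens \<open>w\<close> and hence \<open>ds\<close>. Since
  \<open>t\<close> lengthens \<open>d\<close>, the element \<open>tds\<close> is not longer than \<open>td\<close>, and the exchange condition deletes a
  letter of \<open>td\<close>. Were it a letter of \<open>d\<close>, then \<open>s\<close> would shorten \<open>d\<close>, and \<open>tds\<close> would be too short to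
  come from \<open>td\<close> in one step. So it is \<open>t\<close>, that is, \<open>tds = d\<close>.
\<close>

lemma XJ_mult_gen:
  assumes d: "d \<in> XJ" and s: "s \<in> S" and nX: "d \<otimes> s \<notin> XJ"
  obtains t where "t \<in> J" "d \<otimes> s = t \<otimes> d"
proof -
  have closed: "d \<in> carrier G" "d \<otimes> s \<in> carrier G" using d s by auto
  obtain w c where wc: "w \<in> WJ" "c \<in> XJ" "d \<otimes> s = w \<otimes> c"
    using closed(2) by (rule ex_WJ_XJ)
  have "w \<noteq> \<one>\<^bsub>parabolic G J\<^esub>"
    using wc nX by auto
  with wc(1) obtain t where t: "t \<in> J" "P.len w = Suc (P.len (t \<otimes> w))"
    by (rule P.ex_left_descent) simp
  have tS: "t \<in> S" and tW: "t \<in> WJ" using t(1) J_gen J_in_WJ by auto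
  have "t \<otimes> (d \<otimes> s) = (t \<otimes> w) \<otimes> c"
    using wc tS by (simp add: m_assoc)
  then have shorter: "len (d \<otimes> s) = Suc (len (t \<otimes> (d \<otimes> s)))"
    using wc t tW by (simp add: len_WJ_XJ parabolic_len)
  have td: "len (t \<otimes> d) = Suc (len d)"
  proof -
    have "t \<noteq> \<one>" using t(2) wc(1) by auto
    then have "len t = 1"
      using len_gen_le[OF tS] len_eq_0_iff[of t] tS by force
    then show ?thesis using len_WJ_XJ[OF tW d] by simp
  qed
  have "len (t \<otimes> d \<otimes> s) \<le> len (t \<otimes> d)"
    using shorter td len_mult_gen_le(1)[OF closed(1) s] closed s tS by (simp add: m_assoc)
  then show thesis
  proof (rule exchange_split[OF gen_closed[OF tS] closed(1) s])
    assume "len (d \<otimes> s) < len d"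
    moreover have "len (t \<otimes> d) \<le> Suc (len (t \<otimes> d \<otimes> s))"
      using closed tS s by (intro len_mult_gen_le) auto
    ultimately show thesis
      using closed tS s td shorter by (simp add: m_assoc)
  next
    fix x
    assume x: "x \<in> carrier G" "len x < len t" "t \<otimes> d \<otimes> s = x \<otimes> d"
    then have "len x = 0" using len_gen_le[OF tS] by simp
    then have "t \<otimes> (d \<otimes> s) = d"
      using x closed tS s by (simp add: len_eq_0_iff m_assoc)
    then have "t \<otimes> (t \<otimes> (d \<otimes> s)) = t \<otimes> d" by simp
    then show thesis
      using closed tS t(1) by (intro that) simp_all
  qed
qed

end

section \<open>The longest minimal coset representative\<close>

context parabolic_coxeter_system
begin

text \<open>
  The elements of \<open>X\<^sub>J\<close> that are maximal with respect to right multiplication by a generator; there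
  is just one when the group is finite, namely \<open>d\<^sub>J\<close>.
\<close>

definition dominant_rep :: "'a \<Rightarrow> bool" where
  "dominant_rep d \<longleftrightarrow> d \<in> XJ \<and> (\<forall>s\<in>S. d \<otimes> s \<in> XJ \<longrightarrow> len (d \<otimes> s) < len d)"

lemma ex_longest:
  assumes "finite A" "A \<noteq> {}"
  shows "\<exists>w\<in>A. \<forall>v\<in>A. len v \<le> len w"
proof -
  have "Max (len ` A) \<in> len ` A"
    using assms by (intro Max_in) auto
  then obtain w where "w \<in> A" "len w = Max (len ` A)" by auto
  then show ?thesis
    using assms(1) by (intro bexI[of _ w]) auto
qed

text \<open>
  By Deodhar's lemma, \<open>s\<close> changes either the factor \<open>d\<close>, which it then shortens, or the factor \<open>w\<close>,
  which cannot become longer.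
\<close>

lemma dominant_WJ_rep:
  assumes w: "w \<in> WJ" "\<forall>v\<in>WJ. len v \<le> len w" and d: "dominant_rep d"
  shows "dominant (w \<otimes> d)"
  unfolding dominant_def
proof (intro conjI ballI)
  have dX: "d \<in> XJ" using d by (simp add: dominant_rep_def)
  show wd: "w \<otimes> d \<in> carrier G" using w(1) dX by simp
  fix s assume s: "s \<in> S"
  have "len (w \<otimes> d \<otimes> s) \<le> len (w \<otimes> d)"
  proof (cases "d \<otimes> s \<in> XJ")
    case True
    then have "len (w \<otimes> (d \<otimes> s)) < len (w \<otimes> d)"
      using d s w(1) by (simp add: len_WJ_XJ dominant_rep_def)
    then show ?thesis
      using w(1) dX s by (simp add: m_assoc)
  next
    case False
    obtain t where t: "t \<in> J" "d \<otimes> s = t \<otimes> d"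
      using XJ_mult_gen[OF dX s False] .
    have tW: "t \<in> WJ" using t(1) by (rule J_in_WJ)
    have "w \<otimes> d \<otimes> s = (w \<otimes> t) \<otimes> d"
      using w(1) dX s tW t(2) by (simp add: m_assoc)
    then show ?thesis
      using bspec[OF w(2), of "w \<otimes> t"] w(1) tW dX by (simp add: len_WJ_XJ)
  qed
  then show "len (w \<otimes> d \<otimes> s) < len (w \<otimes> d)"
    using len_mult_gen_cases[OF wd s] by linarith
qed

text \<open>
  Let \<open>x = inv d t d\<close>. The product \<open>wd\<close> with the longest \<open>w \<in> W\<^sub>J\<close> has every element as a suffix, so
  multiplying it by \<open>x\<close> shortens it by the length of \<open>x\<close>. But \<open>wdx = (wt)d\<close> is shorter than \<open>wd\<close> by
  one, so \<open>x\<close> is a generator.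
\<close>

lemma dominant_rep_mult_left:
  assumes "finite WJ" and d: "dominant_rep d" and t: "t \<in> J"
  obtains s where "s \<in> S" "d \<otimes> s = t \<otimes> d"
proof -
  obtain w where w: "w \<in> WJ" "\<forall>v\<in>WJ. len v \<le> len w"
    using ex_longest[OF assms(1)] WJ_one by blast
  have dom: "dominant (w \<otimes> d)"
    using w d by (rule dominant_WJ_rep)
  have dX: "d \<in> XJ" using d by (simp add: dominant_rep_def)
  have tS: "t \<in> S" and tW: "t \<in> WJ" using t J_gen J_in_WJ by auto
  have "len (w \<otimes> t) \<le> len w"
    using w tW by simp
  then have wt: "len w = Suc (len (w \<otimes> t))"
    using len_mult_gen_cases[OF WJ_closed[OF w(1)] tS] by linarith
  define x where "x = inv d \<otimes> t \<otimes> d"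
  have x: "x \<in> carrier G" "d \<otimes> x = t \<otimes> d"
    using dX tS by (simp_all add: x_def m_assoc)
  obtain a where a: "a \<in> carrier G" "w \<otimes> d = a \<otimes> inv x"
    "len (w \<otimes> d) = len a + len (inv x)"
    using dominant_suffix[OF dom, of "inv x"] x(1) by blast
  have "a = w \<otimes> d \<otimes> x"
    using a(1) x(1) unfolding a(2) by (simp add: m_assoc)
  also have "\<dots> = (w \<otimes> t) \<otimes> d"
    using x w(1) dX tW by (simp add: m_assoc)
  finally have "len a = len (w \<otimes> t) + len d"
    using w(1) tW dX by (simp add: len_WJ_XJ)
  then have "len x = 1"
    using a(3) wt w(1) dX x(1) by (simp add: len_WJ_XJ len_inv)
  then show thesis
    using that x len_eq_1_imp_gen by blast
qed

lemma dominant_rep_unique: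
  assumes "finite WJ" "dominant_rep c" "dominant_rep d"
  shows "c = d"
proof -
  obtain w where w: "w \<in> WJ" "\<forall>v\<in>WJ. len v \<le> len w"
    using ex_longest[OF assms(1)] WJ_one by blast
  have "w \<otimes> c = w \<otimes> d"
    using dominant_WJ_rep[OF w] assms(2,3) by (intro dominant_unique)
  then show ?thesis
    using w(1) assms(2,3) by (simp add: dominant_rep_def)
qed

text \<open>
  A step up from an element of maximal length would give a longer one, so such an element is
  \<open>dominant_rep\<close>; the uniqueness of the latter also makes the definite description in
  \<^const>\<open>longest_coset_rep\<close> meaningful.
\<close>

lemma dominant_rep_iff:
  assumes "finite (carrier G)"
  shows "dominant_rep d \<longleftrightarrow> d = longest_coset_rep G S J"
proof -
  define longest where
    "longest d \<longleftrightarrow> d \<in> XJ \<and> (\<forall>x\<in>XJ. len x \<le> len d)" for d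
  have WJ: "finite WJ" and XJ: "finite XJ"
    using finite_subset[OF _ assms] WJ_closed XJ_closed by blast+
  have imp: "dominant_rep d" if "longest d" for d
    unfolding dominant_rep_def
  proof (intro conjI ballI impI)
    show dX: "d \<in> XJ" using that by (simp add: longest_def)
    fix s assume s: "s \<in> S" "d \<otimes> s \<in> XJ"
    then have "len (d \<otimes> s) \<le> len d" using that by (simp add: longest_def)
    then show "len (d \<otimes> s) < len d"
      using len_mult_gen_cases[OF XJ_closed[OF dX] s(1)] by linarith
  qed
  have "XJ \<noteq> {}"
    using ex_WJ_XJ[OF one_closed] by auto
  from ex_longest[OF XJ this] obtain e where e: "longest e"
    unfolding longest_def by blast
  have "longest_coset_rep G S J = (THE d. longest d)"
    by (simp add: longest_coset_rep_def longest_def)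
  also have "\<dots> = e"
    using e dominant_rep_unique[OF WJ] imp by (intro the_equality) auto
  finally show ?thesis
    using e dominant_rep_unique[OF WJ] imp by auto
qed

end

section \<open>Ideals induced from a parabolic subgroup\<close>

context parabolic_coxeter_system
begin

lemma mult_in_ideal_reps_iff:
  assumes "Z \<subseteq> WJ" "z \<in> WJ" "d \<in> XJ"
  shows "z \<otimes> d \<in> Z <#> XJ \<longleftrightarrow> z \<in> Z"
proof
  assume "z \<otimes> d \<in> Z <#> XJ"
  then obtain v c where "v \<in> Z" "c \<in> XJ" "z \<otimes> d = v \<otimes> c"
    by (auto simp: set_mult_def)
  then show "z \<in> Z"
    using WJ_XJ_unique[of z v d c] assms by auto
qed (use assms in \<open>auto simp: set_mult_def\<close>)

lemma parabolic_right_ideal_iff: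
  "right_ideal (parabolic G J) J Z \<longleftrightarrow>
    Z \<subseteq> WJ \<and> (\<forall>z\<in>Z. \<forall>t\<in>J. len (z \<otimes> t) < len z \<longrightarrow> z \<otimes> t \<in> Z)"
  unfolding P.right_ideal_iff_steps
  using J_in_WJ by (auto simp: parabolic_len subset_iff)

lemma parabolic_minimal_determining_set_iff:
  assumes "right_ideal (parabolic G J) J Z"
  shows "z \<in> minimal_determining_set (parabolic G J) J Z \<longleftrightarrow>
    z \<in> Z \<and> (\<forall>t\<in>J. len z < len (z \<otimes> t) \<longrightarrow> z \<otimes> t \<notin> Z)"
  unfolding P.minimal_determining_set_iff_steps[OF assms]
  using J_in_WJ assms by (auto simp: parabolic_len right_ideal_def subset_iff)

text \<open>
  A shortening step on \<open>zd\<close> alters only \<open>d\<close> within \<open>X\<^sub>J\<close>, or it is a shortening step of \<open>z\<close> within \<open>W\<^sub>J\<close>,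
  which \<open>Z\<close> permits.
\<close>

theorem right_ideal_mult_reps:
  assumes "right_ideal (parabolic G J) J Z"
  shows "right_ideal G S (Z <#> XJ)"
  unfolding right_ideal_iff_steps
proof (intro conjI ballI impI)
  from assms have Z: "Z \<subseteq> WJ" "\<And>z t. z \<in> Z \<Longrightarrow> t \<in> J \<Longrightarrow> len (z \<otimes> t) < len z \<Longrightarrow> z \<otimes> t \<in> Z"
    unfolding parabolic_right_ideal_iff by auto
  then show "Z <#> XJ \<subseteq> carrier G"
    by (intro set_mult_closed) auto
  fix y s
  assume "y \<in> Z <#> XJ" and s: "s \<in> S" "len (y \<otimes> s) < len y"
  then obtain z d where zd: "z \<in> Z" "d \<in> XJ" "y = z \<otimes> d"
    by (auto simp: set_mult_def)
  have zW: "z \<in> WJ" using zd(1) Z(1) by blast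
  show "y \<otimes> s \<in> Z <#> XJ"
  proof (cases "d \<otimes> s \<in> XJ")
    case True
    have "y \<otimes> s = z \<otimes> (d \<otimes> s)"
      using zd zW s by (simp add: m_assoc)
    with True zd(1) show ?thesis by (auto simp: set_mult_def)
  next
    case False
    obtain t where t: "t \<in> J" "d \<otimes> s = t \<otimes> d"
      using XJ_mult_gen[OF zd(2) s(1) False] .
    have tW: "t \<in> WJ" using t(1) by (rule J_in_WJ)
    have eq: "y \<otimes> s = (z \<otimes> t) \<otimes> d"
      using zd zW s(1) t(2) tW by (simp add: m_assoc)
    have "len (z \<otimes> t) < len z"
      using s(2) zW tW zd(2) unfolding eq unfolding zd(3) by (simp add: len_WJ_XJ)
    then have "z \<otimes> t \<in> Z"
      using Z(2) zd(1) t(1) by blast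
    then show ?thesis
      using zd(2) eq by (auto simp: set_mult_def)
  qed
qed

text \<open>
  For \<open>d\<close> other than \<open>d\<^sub>J\<close> some step \<open>zd \<mapsto> z(ds)\<close> goes up inside the ideal. For \<open>d = d\<^sub>J\<close> the steps that go
  up correspond to steps \<open>z \<mapsto> zt\<close> with \<open>t \<in> J\<close>.
\<close>

theorem minimal_determining_set_mult_reps:
  assumes fin: "finite (carrier G)" and ideal: "right_ideal (parabolic G J) J Z"
  shows "minimal_determining_set G S (Z <#> XJ) =
    minimal_determining_set (parabolic G J) J Z #> longest_coset_rep G S J"
proof -
  let ?Y = "minimal_determining_set (parabolic G J) J Z"
  let ?M = "minimal_determining_set G S (Z <#> XJ)"
  let ?d = "longest_coset_rep G S J"
  note M = minimal_determining_set_iff_steps[OF right_ideal_mult_reps[OF ideal]]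
  note Y = parabolic_minimal_determining_set_iff[OF ideal]
  have Z: "Z \<subseteq> WJ" using ideal by (simp add: right_ideal_def)
  have WJ: "finite WJ"
    using finite_subset[OF _ fin] WJ_closed by blast
  have iff: "z \<otimes> d \<in> ?M \<longleftrightarrow> z \<in> ?Y \<and> d = ?d" if z: "z \<in> Z" and d: "d \<in> XJ" for z d
  proof -
    have zW: "z \<in> WJ" using z Z by blast
    have zd: "z \<otimes> d \<in> Z <#> XJ" using mult_in_ideal_reps_iff[OF Z zW d] z by simp
    show ?thesis
    proof (cases "dominant_rep d")
      case False
      then obtain s where s: "s \<in> S" "d \<otimes> s \<in> XJ" "\<not> len (d \<otimes> s) < len d"
        using d by (auto simp: dominant_rep_def)
      then have "len d < len (d \<otimes> s)"
        using len_mult_gen_cases[OF XJ_closed[OF d] s(1)] by linarith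
      then have "len (z \<otimes> d) < len (z \<otimes> (d \<otimes> s))"
        using zW d s(2) by (simp add: len_WJ_XJ)
      moreover have "z \<otimes> (d \<otimes> s) \<in> Z <#> XJ"
        using mult_in_ideal_reps_iff[OF Z zW s(2)] z by simp
      ultimately have "z \<otimes> d \<notin> ?M"
        unfolding M using s(1) zW d by (auto simp: m_assoc intro!: bexI[of _ s])
      with False show ?thesis
        by (simp add: dominant_rep_iff[OF fin])
    next
      case True
      \<comment> \<open>A step of the second kind on \<open>zd\<close> is a step of \<open>z\<close> in \<open>W\<^sub>J\<close>, with equivalent effects.\<close>
      have step: "z \<otimes> d \<otimes> s = (z \<otimes> t) \<otimes> d \<and>
          (len (z \<otimes> d) < len (z \<otimes> d \<otimes> s) \<longleftrightarrow> len z < len (z \<otimes> t)) \<and>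
          (z \<otimes> d \<otimes> s \<in> Z <#> XJ \<longleftrightarrow> z \<otimes> t \<in> Z)"
        if "s \<in> S" "t \<in> J" "d \<otimes> s = t \<otimes> d" for s t
      proof -
        have tW: "t \<in> WJ" using that(2) by (rule J_in_WJ)
        have eq: "z \<otimes> d \<otimes> s = (z \<otimes> t) \<otimes> d"
          using that zW d tW by (simp add: m_assoc)
        show ?thesis
          unfolding eq using zW tW d Z
          by (simp add: len_WJ_XJ mult_in_ideal_reps_iff)
      qed
      have "z \<otimes> d \<in> ?M \<longleftrightarrow> z \<in> ?Y"
        unfolding M Y
      proof (intro conj_cong iffI ballI impI)
        fix t
        assume M: "\<forall>s\<in>S. len (z \<otimes> d) < len (z \<otimes> d \<otimes> s) \<longrightarrow> z \<otimes> d \<otimes> s \<notin> Z <#> XJ"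
          and t: "t \<in> J" "len z < len (z \<otimes> t)"
        obtain s where s: "s \<in> S" "d \<otimes> s = t \<otimes> d"
          using dominant_rep_mult_left[OF WJ True t(1)] .
        show "z \<otimes> t \<notin> Z"
          using M step[OF s(1) t(1) s(2)] t(2) s(1) by blast
      next
        fix s
        assume Y: "\<forall>t\<in>J. len z < len (z \<otimes> t) \<longrightarrow> z \<otimes> t \<notin> Z"
          and s: "s \<in> S" "len (z \<otimes> d) < len (z \<otimes> d \<otimes> s)"
        have "d \<otimes> s \<notin> XJ"
        proof
          assume ds: "d \<otimes> s \<in> XJ"
          then have "len (d \<otimes> s) < len d"
            using True s(1) by (simp add: dominant_rep_def)
          then have "len (z \<otimes> (d \<otimes> s)) < len (z \<otimes> d)"
            using zW d ds by (simp add: len_WJ_XJ)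
          then show False
            using s zW d by (simp add: m_assoc)
        qed
        then obtain t where t: "t \<in> J" "d \<otimes> s = t \<otimes> d"
          using XJ_mult_gen[OF d s(1)] by blast
        show "z \<otimes> d \<otimes> s \<notin> Z <#> XJ"
          using Y step[OF s(1) t] s(2) t(1) by blast
      qed (use z zd in simp_all)
      with True show ?thesis
        by (simp add: dominant_rep_iff[OF fin])
    qed
  qed
  have dX: "?d \<in> XJ"
    using dominant_rep_iff[OF fin, of ?d] unfolding dominant_rep_def by blast
  have MZ: "x \<in> Z <#> XJ" if "x \<in> ?M" for x
    using that by (simp add: minimal_determining_set_def)
  have YZ: "z \<in> Z" if "z \<in> ?Y" for z
    using that by (simp add: minimal_determining_set_def)
  show ?thesis
  proof (intro equalityI subsetI)
    fix x assume x: "x \<in> ?M"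
    obtain z d where zd: "z \<in> Z" "d \<in> XJ" "x = z \<otimes> d"
      using MZ[OF x] by (auto simp: set_mult_def)
    then show "x \<in> ?Y #> ?d"
      using iff x by (auto simp: r_coset_def)
  next
    fix x assume "x \<in> ?Y #> ?d"
    then obtain z where "z \<in> ?Y" "x = z \<otimes> ?d"
      by (auto simp: r_coset_def)
    then show "x \<in> ?M"
      using iff[of z ?d] YZ dX by simp
  qed
qed

end

theorem proposition2p10:
  fixes W :: "('a, 'b) monoid_scheme" and S J Y Z :: "'a set"
  assumes "coxeter_system W S"
    and "finite (carrier W)"
    and "J \<subseteq> S"
    and "right_ideal (parabolic W J) J Z"
    and "Y = minimal_determining_set (parabolic W J) J Z"
  shows "right_ideal W S (Z <#>\<^bsub>W\<^esub> min_coset_reps W S J) \<and>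
    minimal_determining_set W S (Z <#>\<^bsub>W\<^esub> min_coset_reps W S J)
      = Y #>\<^bsub>W\<^esub> longest_coset_rep W S J"
proof -
  interpret parabolic_coxeter_system W S J
    using assms(1,3) by (intro parabolic_coxeter_system.intro parabolic_coxeter_system_axioms.intro)
  show ?thesis
    using right_ideal_mult_reps minimal_determining_set_mult_reps assms(2,4,5) by blast
qed

end
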